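(* Let $\Gamma$ be a finite set of sentences and $\varphi$ a sentence of the logic of strict majorities. If $\Gamma\vdash\varphi$, then every measurable model that satisfies all sentences of $\Gamma$ also satisfies $\varphi$.
   Context: Syntax. Fix atomic predicates $X_1,X_2,\dots$. Terms: $t ::= X \mid \neg t\mid t\wedge t$. Sentences: $\varphi ::= \mathsf{A}\,t\mid \mathsf{M}\,t\mid\neg\varphi\mid\varphi\wedge\varphi$. Other Boolean connectives (on terms and on sentences) are abbreviations as usual; empty conjunctions are $\top$ and empty disjunctions are $\bot$. The term $\bot$ is $X\wedge\neg X$ and $\top$ is $\neg\bot$. Abbreviations: $\mathsf{H}\,t$ is $\neg\mathsf{M}\,t\wedge\neg\mathsf{M}\,\neg t$; $\mathsf{L}\,t$ is $\mathsf{M}\,t\vee\mathsf{H}\,t$; $\mathsf{E}\,t$ is $\neg\mathsf{A}\,\neg t$. Terms are taken modulo Boolean equivalence: if $t,t'$ are equivalent by the equational laws of Boolean algebra, then $\mathsf{A}\,t$ and $\mathsf{A}\,t'$ are identified, and $\mathsf{M}\,t$ and $\mathsf{M}\,t'$ are identified. Semantics. A finite social decision frame is a pair $(W,\mathcal{M})$ with $W$ a nonempty finite set and $\mathcal{M}$ a family of subsets of $W$. It is measurable if there is a finitely additive natural-number-valued $\mu$ on subsets of $W$ with $\mu(\varnothing)=0$, $\mu(\{w\})>0$ for all $w\in W$, and, for all $A\subseteq W$, $A\in\mathcal{M}$ iff $\mu(A)>\frac12\mu(W)$. A model is a frame with a set $[\![X]\!]\subseteq W$ for each atomic predicate $X$;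 it is measurable if its frame is. Put $[\![\neg t]\!]=W\setminus[\![t]\!]$ and $[\![t\wedge u]\!]=[\![t]\!]\cap[\![u]\!]$. The model satisfies $\mathsf{A}\,t$ iff $[\![t]\!]=W$, and satisfies $\mathsf{M}\,t$ iff $[\![t]\!]\in\mathcal{M}$; sentential connectives are classical. Proof system. The only rule is modus ponens. Axioms: (i) all sentences that are substitution instances of propositional tautologies; (ii) $\mathsf{E}\,\top\wedge\mathsf{A}\,\top$; (iii) $\mathsf{A}(t\to u)\to(\mathsf{A}\,t\to\mathsf{A}\,u)$ for all terms $t,u$; (iv) coherence: for every finite sequence of terms $u_1,\dots,u_k$, $$\Bigl(\bigwedge_{i\le k}\mathsf{L}\,u_i\wedge\mathsf{A}\Bigl(\bigvee_{S\subseteq[k],\,|S|\ge k/2}\ \bigwedge_{i\in S}\neg u_i\Bigr)\Bigr)\to\Bigl(\bigwedge_{i\le k}\mathsf{H}\,u_i\wedge\mathsf{A}\Bigl(\bigvee_{S\subseteq[k],\,|S|= k/2}\bigl(\bigwedge_{i\in S}u_i\wedge\bigwedge_{i\notin S}\neg u_i\bigr)\Bigr)\Bigr),$$ where $[k]=\{1,\dots,k\}$. $\Gamma\vdash\varphi$ means that $\varphi$ is derivable from $\Gamma$ and the axioms by modus ponens. *)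

theory Defs imports Complex_Main begin

section \<open>Terms modulo Boolean equivalence\<close>

text \<open>\<open>RAtom n\<close> is the atomic predicate \<open>X\<^sub>n\<^sub>+\<^sub>1\<close>.\<close>

datatype rtrm = RAtom nat | RNeg rtrm | RConj rtrm rtrm

definition RDisj :: "rtrm \<Rightarrow> rtrm \<Rightarrow> rtrm" where
  "RDisj t u = RNeg (RConj (RNeg t) (RNeg u))"

definition RBot :: rtrm where
  "RBot = RConj (RAtom 0) (RNeg (RAtom 0))"

definition RTop :: rtrm where
  "RTop = RNeg RBot"

text \<open>
  Provable equality in the equational theory of Boolean algebras.  The laws for the two
  constants as units and the De Morgan and double negation laws follow from those listed.
\<close>

inductive beq :: "rtrm \<Rightarrow> rtrm \<Rightarrow> bool" where
  beq_refl: "beq t t"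
| beq_sym: "beq t u \<Longrightarrow> beq u t"
| beq_trans: "beq t u \<Longrightarrow> beq u v \<Longrightarrow> beq t v"
| beq_Neg: "beq t t' \<Longrightarrow> beq (RNeg t) (RNeg t')"
| beq_Conj: "beq t t' \<Longrightarrow> beq u u' \<Longrightarrow> beq (RConj t u) (RConj t' u')"
| conj_comm: "beq (RConj t u) (RConj u t)"
| disj_comm: "beq (RDisj t u) (RDisj u t)"
| conj_assoc: "beq (RConj (RConj t u) v) (RConj t (RConj u v))"
| disj_assoc: "beq (RDisj (RDisj t u) v) (RDisj t (RDisj u v))"
| conj_absorb: "beq (RConj t (RDisj t u)) t"
| disj_absorb: "beq (RDisj t (RConj t u)) t"
| conj_distrib: "beq (RConj t (RDisj u v)) (RDisj (RConj t u) (RConj t v))"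
| disj_distrib: "beq (RDisj t (RConj u v)) (RConj (RDisj t u) (RDisj t v))"
| conj_compl: "beq (RConj t (RNeg t)) RBot"
| disj_compl: "beq (RDisj t (RNeg t)) RTop"

lemma equivp_beq: "equivp beq"
  by (intro equivpI reflpI sympI transpI) (blast intro: beq_refl beq_sym beq_trans)+

quotient_type trm = rtrm / beq
  by (rule equivp_beq)

lift_definition Atom :: "nat \<Rightarrow> trm" is RAtom .
lift_definition Neg :: "trm \<Rightarrow> trm" is RNeg by (rule beq_Neg)
lift_definition Conj :: "trm \<Rightarrow> trm \<Rightarrow> trm" is RConj by (rule beq_Conj)

definition Disj :: "trm \<Rightarrow> trm \<Rightarrow> trm" where
  "Disj t u = Neg (Conj (Neg t) (Neg u))"

definition Imp :: "trm \<Rightarrow> trm \<Rightarrow> trm" where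
  "Imp t u = Disj (Neg t) u"

definition Bot :: trm where
  "Bot = Conj (Atom 0) (Neg (Atom 0))"

definition Top :: trm where
  "Top = Neg Bot"

definition BigConj :: "trm list \<Rightarrow> trm" where
  "BigConj ts = foldr Conj ts Top"

definition BigDisj :: "trm list \<Rightarrow> trm" where
  "BigDisj ts = foldr Disj ts Bot"


section \<open>Sentences\<close>

datatype sentence =
    SA trm
  | SM trm
  | SNeg sentence
  | SConj sentence sentence

definition SDisj :: "sentence \<Rightarrow> sentence \<Rightarrow> sentence" where
  "SDisj p q = SNeg (SConj (SNeg p) (SNeg q))"

definition SImp :: "sentence \<Rightarrow> sentence \<Rightarrow> sentence" where
  "SImp p q = SDisj (SNeg p) q"

definition STop :: sentence where
  "STop = SNeg (SConj (SA Top) (SNeg (SA Top)))"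

fun SBigConj :: "sentence list \<Rightarrow> sentence" where
  "SBigConj [] = STop"
| "SBigConj [p] = p"
| "SBigConj (p # q # ps) = SConj p (SBigConj (q # ps))"

definition SH :: "trm \<Rightarrow> sentence" where
  "SH t = SConj (SNeg (SM t)) (SNeg (SM (Neg t)))"

definition SL :: "trm \<Rightarrow> sentence" where
  "SL t = SDisj (SM t) (SH t)"

definition SE :: "trm \<Rightarrow> sentence" where
  "SE t = SNeg (SA (Neg t))"


section \<open>Models\<close>

record 'w frame =
  worlds :: "'w set"
  majorities :: "'w set set"

record 'w model = "'w frame" +
  val :: "nat \<Rightarrow> 'w set"

definition frame :: "('w, 'b) frame_scheme \<Rightarrow> bool" where
  "frame F \<longleftrightarrow> finite (worlds F) \<and> worlds F \<noteq> {} \<and> majorities F \<subseteq> Pow (worlds F)"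

definition measurable_frame :: "('w, 'b) frame_scheme \<Rightarrow> bool" where
  "measurable_frame F \<longleftrightarrow> frame F \<and>
     (\<exists>\<mu> :: 'w set \<Rightarrow> nat.
        \<mu> {} = 0 \<and>
        (\<forall>A B. A \<subseteq> worlds F \<longrightarrow> B \<subseteq> worlds F \<longrightarrow> A \<inter> B = {} \<longrightarrow> \<mu> (A \<union> B) = \<mu> A + \<mu> B) \<and>
        (\<forall>w \<in> worlds F. \<mu> {w} > 0) \<and>
        (\<forall>A. A \<subseteq> worlds F \<longrightarrow>
           (A \<in> majorities F \<longleftrightarrow> real (\<mu> A) > 1 / 2 * real (\<mu> (worlds F)))))"

definition model :: "'w model \<Rightarrow> bool" where
  "model \<MM> \<longleftrightarrow> frame \<MM> \<and> (\<forall>n. val \<MM> n \<subseteq> worlds \<MM>)"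

definition measurable_model :: "'w model \<Rightarrow> bool" where
  "measurable_model \<MM> \<longleftrightarrow> model \<MM> \<and> measurable_frame \<MM>"

text \<open>
  The intersection with \<open>worlds \<MM>\<close> in the atomic case has no effect on elements of
  \<open>model\<close> (see \<open>den_Atom\<close> below); it makes the denotation respect \<open>beq\<close>
  for arbitrary records.
\<close>

primrec rden :: "'w model \<Rightarrow> rtrm \<Rightarrow> 'w set" where
  "rden \<MM> (RAtom n) = worlds \<MM> \<inter> val \<MM> n"
| "rden \<MM> (RNeg t) = worlds \<MM> - rden \<MM> t"
| "rden \<MM> (RConj t u) = rden \<MM> t \<inter> rden \<MM> u"

lemma rden_subset: "rden \<MM> t \<subseteq> worlds \<MM>"
  by (induction t) auto

lemma rden_beq: "beq t u \<Longrightarrow> rden \<MM> t = rden \<MM> u"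
proof (induction rule: beq.induct)
qed (use rden_subset[of \<MM>] in \<open>auto simp: RDisj_def RBot_def RTop_def\<close>)

lift_definition den :: "'w model \<Rightarrow> trm \<Rightarrow> 'w set" is rden
  by (rule rden_beq)

lemma den_Atom: "model \<MM> \<Longrightarrow> den \<MM> (Atom n) = val \<MM> n"
  unfolding model_def by transfer auto

lemma den_Neg: "den \<MM> (Neg t) = worlds \<MM> - den \<MM> t"
  by transfer simp

lemma den_Conj: "den \<MM> (Conj t u) = den \<MM> t \<inter> den \<MM> u"
  by transfer simp

primrec sat :: "'w model \<Rightarrow> sentence \<Rightarrow> bool" (infix "\<Turnstile>" 50) where
  "\<MM> \<Turnstile> SA t \<longleftrightarrow> den \<MM> t = worlds \<MM>"
| "\<MM> \<Turnstile> SM t \<longleftrightarrow> den \<MM> t \<in> majorities \<MM>"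
| "\<MM> \<Turnstile> SNeg p \<longleftrightarrow> \<not> \<MM> \<Turnstile> p"
| "\<MM> \<Turnstile> SConj p q \<longleftrightarrow> \<MM> \<Turnstile> p \<and> \<MM> \<Turnstile> q"


section \<open>Proof system\<close>

datatype pform = PVar nat | PNeg pform | PConj pform pform

primrec peval :: "(nat \<Rightarrow> bool) \<Rightarrow> pform \<Rightarrow> bool" where
  "peval v (PVar n) \<longleftrightarrow> v n"
| "peval v (PNeg p) \<longleftrightarrow> \<not> peval v p"
| "peval v (PConj p q) \<longleftrightarrow> peval v p \<and> peval v q"

definition tautology :: "pform \<Rightarrow> bool" where
  "tautology p \<longleftrightarrow> (\<forall>v. peval v p)"

primrec psubst :: "(nat \<Rightarrow> sentence) \<Rightarrow> pform \<Rightarrow> sentence" where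
  "psubst \<sigma> (PVar n) = \<sigma> n"
| "psubst \<sigma> (PNeg p) = SNeg (psubst \<sigma> p)"
| "psubst \<sigma> (PConj p q) = SConj (psubst \<sigma> p) (psubst \<sigma> q)"

text \<open>
  A sequence \<open>u\<^sub>1, \<dots>, u\<^sub>k\<close> is a list indexed by \<open>[0..<k]\<close>.  The sublists
  \<open>subseqs [0..<k]\<close> enumerate the subsets of the index set, each exactly once and
  without repeated elements, so that \<open>length S\<close> is the size of the subset.
\<close>

definition index_sets :: "nat \<Rightarrow> (nat list \<Rightarrow> bool) \<Rightarrow> nat list list" where
  "index_sets k P = filter P (subseqs [0..<k])"

definition coherence :: "trm list \<Rightarrow> sentence" where
  "coherence us = (let k = length us in
     SImp
       (SConj
         (SBigConj (map SL us))
         (SA (BigDisj (map (\<lambda>S. BigConj (map (\<lambda>i. Neg (us ! i)) S))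
               (index_sets k (\<lambda>S. real (length S) \<ge> real k / 2))))))
       (SConj
         (SBigConj (map SH us))
         (SA (BigDisj (map (\<lambda>S. Conj
                 (BigConj (map (\<lambda>i. us ! i) S))
                 (BigConj (map (\<lambda>i. Neg (us ! i)) (filter (\<lambda>i. i \<notin> set S) [0..<k]))))
               (index_sets k (\<lambda>S. real (length S) = real k / 2)))))))"

inductive_set axioms :: "sentence set" where
  taut: "tautology p \<Longrightarrow> psubst \<sigma> p \<in> axioms"
| E_A_Top: "SConj (SE Top) (SA Top) \<in> axioms"
| A_Imp: "SImp (SA (Imp t u)) (SImp (SA t) (SA u)) \<in> axioms"
| coh: "coherence us \<in> axioms"

inductive derives :: "sentence set \<Rightarrow> sentence \<Rightarrow> bool" (infix "\<turnstile>" 50)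
  for \<Gamma> :: "sentence set" where
  hyp: "p \<in> \<Gamma> \<Longrightarrow> \<Gamma> \<turnstile> p"
| ax: "p \<in> axioms \<Longrightarrow> \<Gamma> \<turnstile> p"
| mp: "\<Gamma> \<turnstile> SImp p q \<Longrightarrow> \<Gamma> \<turnstile> p \<Longrightarrow> \<Gamma> \<turnstile> q"

end

theory Submission imports Defs begin

text \<open>
  Only the coherence axioms are not routine.  Give each world \<open>w\<close> the weight \<open>\<mu> {w}\<close> and let
  \<open>c w\<close> be the number of indices \<open>i\<close> with \<open>w \<in> \<lbrakk>u\<^sub>i\<rbrakk>\<close>.  The weighted
  sum of \<open>c\<close> is \<open>\<Sum>\<^sub>i \<mu> \<lbrakk>u\<^sub>i\<rbrakk>\<close>, which is at least \<open>k \<mu> W / 2\<close> if all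
  \<open>L u\<^sub>i\<close> hold; the covering hypothesis says that \<open>c \<le> k / 2\<close> pointwise.  Since all weights
  are positive, both inequalities must be equalities term by term.
\<close>

lemma double_counting_equality:
  fixes m :: "'w \<Rightarrow> nat"
  assumes fin: "finite W" "finite I"
    and pos: "\<And>w. w \<in> W \<Longrightarrow> 0 < m w"
    and large: "\<And>i. i \<in> I \<Longrightarrow> sum m W \<le> 2 * sum m (W \<inter> A i)"
    and sparse: "\<And>w. w \<in> W \<Longrightarrow> 2 * card {i \<in> I. w \<in> A i} \<le> card I"
  shows "\<And>i. i \<in> I \<Longrightarrow> 2 * sum m (W \<inter> A i) = sum m W"
    and "\<And>w. w \<in> W \<Longrightarrow> 2 * card {i \<in> I. w \<in> A i} = card I"
proof -
  have "(\<Sum>i\<in>I. sum m (W \<inter> A i)) = (\<Sum>i\<in>I. \<Sum>w\<in>W. if w \<in> A i then m w else 0)"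
    by (simp add: sum.inter_restrict fin)
  also have "\<dots> = (\<Sum>w\<in>W. \<Sum>i\<in>I. if w \<in> A i then m w else 0)"
    by (rule sum.swap)
  also have "\<dots> = (\<Sum>w\<in>W. m w * card {i \<in> I. w \<in> A i})"
    by (simp add: sum.inter_filter[symmetric] fin mult.commute)
  finally have count: "(\<Sum>i\<in>I. 2 * sum m (W \<inter> A i)) = (\<Sum>w\<in>W. m w * (2 * card {i \<in> I. w \<in> A i}))"
    by (simp add: sum_distrib_left[symmetric] mult.left_commute[of _ 2])
  have upper: "(\<Sum>w\<in>W. m w * (2 * card {i \<in> I. w \<in> A i})) \<le> (\<Sum>w\<in>W. m w * card I)"
    by (intro sum_mono mult_le_mono2 sparse)
  have lower: "(\<Sum>i\<in>I. sum m W) \<le> (\<Sum>i\<in>I. 2 * sum m (W \<inter> A i))"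
    by (intro sum_mono large)
  \<comment> \<open>By \<open>total\<close>, the chain \<open>lower\<close>, \<open>count\<close>,
    \<open>upper\<close> ends at the value where it starts, so both of its inequalities are
    equalities of sums. A termwise inequality with equal sums is an equality in each term, which is
    what \<open>sum_mono_inv\<close> extracts below.\<close>
  have total: "(\<Sum>w\<in>W. m w * card I) = (\<Sum>i\<in>I. sum m W)"
    by (subst sum_distrib_right[symmetric]) (simp add: mult.commute)
  show "2 * sum m (W \<inter> A i) = sum m W" if "i \<in> I" for i
    using sum_mono_inv[of "\<lambda>_. sum m W" I "\<lambda>i. 2 * sum m (W \<inter> A i)" i]
      large count upper lower total that fin by simp
  show "2 * card {i \<in> I. w \<in> A i} = card I" if "w \<in> W" for w
  proof -
    have "m w * (2 * card {i \<in> I. w \<in> A i}) = m w * card I"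
      using sum_mono_inv[of "\<lambda>w. m w * (2 * card {i \<in> I. w \<in> A i})" W "\<lambda>w. m w * card I" w]
        sparse count upper lower total that fin by simp
    then show ?thesis using pos[OF that] by simp
  qed
qed

text \<open>Passes from the set function of a measurable frame to weights on points, the form in
  which double counting applies.\<close>

lemma additive_eq_sum_singletons:
  fixes \<mu> :: "'w set \<Rightarrow> nat"
  assumes "\<mu> {} = 0"
    and add: "\<And>A B. A \<subseteq> W \<Longrightarrow> B \<subseteq> W \<Longrightarrow> A \<inter> B = {} \<Longrightarrow> \<mu> (A \<union> B) = \<mu> A + \<mu> B"
    and "finite A" "A \<subseteq> W"
  shows "\<mu> A = (\<Sum>w\<in>A. \<mu> {w})"
  using assms(3,4)
proof (induction A)
  case (insert x A)
  then show ?case using add[of "{x}" A] by simp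
qed (simp add: assms(1))

lemma den_subset: "den \<MM> t \<subseteq> worlds \<MM>"
  by transfer (rule rden_subset)

lemma den_Disj: "den \<MM> (Disj t u) = den \<MM> t \<union> den \<MM> u"
  using den_subset[of \<MM>] by (auto simp: Disj_def den_Neg den_Conj)

lemma den_Bot: "den \<MM> Bot = {}"
  by (auto simp: Bot_def den_Neg den_Conj)

lemma den_Top: "den \<MM> Top = worlds \<MM>"
  by (simp add: Top_def den_Neg den_Bot)

text \<open>The bound \<open>w \<in> worlds \<MM>\<close> accounts for the empty list, whose
  conjunction is \<open>Top\<close>.\<close>

lemma den_BigConj: "den \<MM> (BigConj ts) = {w \<in> worlds \<MM>. \<forall>t\<in>set ts. w \<in> den \<MM> t}"
proof (induction ts)
  case (Cons t ts)
  then show ?case using den_subset[of \<MM> t] by (auto simp: BigConj_def den_Conj)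
qed (simp add: BigConj_def den_Top)

lemma den_BigDisj: "den \<MM> (BigDisj ts) = (\<Union>t\<in>set ts. den \<MM> t)"
  by (induction ts) (auto simp: BigDisj_def den_Bot den_Disj)

lemma sat_SImp: "\<MM> \<Turnstile> SImp p q \<longleftrightarrow> (\<MM> \<Turnstile> p \<longrightarrow> \<MM> \<Turnstile> q)"
  by (auto simp: SImp_def SDisj_def)

lemma sat_SBigConj: "\<MM> \<Turnstile> SBigConj ps \<longleftrightarrow> (\<forall>p\<in>set ps. \<MM> \<Turnstile> p)"
  by (induction ps rule: SBigConj.induct) (auto simp: STop_def)

text \<open>A model and a substitution together induce a truth assignment to the propositional
  variables; this reduces the tautology axioms to truth tables.\<close>

lemma sat_psubst: "\<MM> \<Turnstile> psubst \<sigma> p \<longleftrightarrow> peval (\<lambda>n. \<MM> \<Turnstile> \<sigma> n) p"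
  by (induction p) auto

text \<open>The sentence \<open>coherence us\<close> measures index sets by the length of a list. A
  sublist of the distinct list \<open>[0..<k]\<close> is distinct, so this length is the cardinality
  used in the counting.\<close>

lemma length_subseq_upt:
  assumes "S \<in> set (subseqs [0..<k])"
  shows "length S = card (set S)" and "set S \<subseteq> {..<k}"
proof -
  show "length S = card (set S)"
    using subseqs_distinctD[OF assms] by (simp add: distinct_card)
  show "set S \<subseteq> {..<k}"
    using assms subseqs_powset[of "[0..<k]"] by (auto simp: lessThan_atLeast0)
qed

text \<open>Every set of indices is enumerated, so a disjunct of the coherence conclusion can be
  chosen by naming its set.\<close>

lemma subseq_upt_exists:
  assumes "T \<subseteq> {..<k}"
  obtains S where "S \<in> set (subseqs [0..<k])" "set S = T"
proof -
  have "T \<in> set ` set (subseqs [0..<k])"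
    using assms by (simp add: subseqs_powset lessThan_atLeast0)
  then show thesis using that by blast
qed

lemma coherence_sound:
  assumes "measurable_model \<MM>"
  shows "\<MM> \<Turnstile> coherence us"
proof -
  define W where "W = worlds \<MM>"
  define k where "k = length us"
  define A where "A i = den \<MM> (us ! i)" for i
  have A_sub: "A i \<subseteq> W" for i
    by (simp add: A_def W_def den_subset)
  have fin: "finite W"
    using assms by (simp add: measurable_model_def model_def frame_def W_def)
  obtain \<mu> :: "'a set \<Rightarrow> nat" where \<mu>0: "\<mu> {} = 0"
    and add: "\<And>B C. B \<subseteq> W \<Longrightarrow> C \<subseteq> W \<Longrightarrow> B \<inter> C = {} \<Longrightarrow> \<mu> (B \<union> C) = \<mu> B + \<mu> C"
    and pos: "\<And>w. w \<in> W \<Longrightarrow> \<mu> {w} > 0"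
    and maj: "\<And>B. B \<subseteq> W \<Longrightarrow> B \<in> majorities \<MM> \<longleftrightarrow> real (\<mu> B) > 1 / 2 * real (\<mu> W)"
    using assms unfolding measurable_model_def measurable_frame_def W_def
    by (elim conjE exE) (rule that[unfolded W_def]; simp)
  define m where "m w = \<mu> {w}" for w
  have \<mu>_sum: "\<mu> B = sum m B" if "B \<subseteq> W" for B
    unfolding m_def
    by (rule additive_eq_sum_singletons[of \<mu> W B, OF \<mu>0 _ finite_subset[OF that fin] that]) (rule add)
  have m_pos: "0 < m w" if "w \<in> W" for w
    using pos[OF that] by (simp add: m_def)
  have compl: "\<mu> W = \<mu> B + \<mu> (W - B)" if "B \<subseteq> W" for B
    using add[of B "W - B"] that by (simp add: Un_absorb1)
  have maj': "B \<in> majorities \<MM> \<longleftrightarrow> \<mu> W < 2 * \<mu> B" if "B \<subseteq> W" for B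
    using maj[OF that] by linarith
  \<comment> \<open>By \<open>compl\<close>, a set and its complement both fail to be strict
    majorities exactly when each carries half of the weight. So \<open>SH\<close> expresses exactly
    half, and \<open>SL\<close> at least half.\<close>
  have sat_SL: "\<MM> \<Turnstile> SL t \<longleftrightarrow> \<mu> W \<le> 2 * \<mu> (den \<MM> t)" for t
    using maj'[of "den \<MM> t"] maj'[of "W - den \<MM> t"] compl[of "den \<MM> t"] den_subset[of \<MM> t]
    by (auto simp: SL_def SH_def SDisj_def den_Neg W_def)
  have sat_SH: "\<MM> \<Turnstile> SH t \<longleftrightarrow> 2 * \<mu> (den \<MM> t) = \<mu> W" for t
    using maj'[of "den \<MM> t"] maj'[of "W - den \<MM> t"] compl[of "den \<MM> t"] den_subset[of \<MM> t]
    by (auto simp: SH_def den_Neg W_def)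
  \<comment> \<open>An inclusion suffices for the second conjunct: denotations never leave
    \<open>W\<close>, so the last step turns it into an equality.\<close>
  have "\<MM> \<Turnstile> SBigConj (map SH us) \<and>
    W \<subseteq> den \<MM> (BigDisj (map (\<lambda>S. Conj (BigConj (map (\<lambda>i. us ! i) S))
             (BigConj (map (\<lambda>i. Neg (us ! i)) (filter (\<lambda>i. i \<notin> set S) [0..<k]))))
           (index_sets k (\<lambda>S. real (length S) = real k / 2))))"
    (is "_ \<and> W \<subseteq> ?D")
    if L: "\<MM> \<Turnstile> SBigConj (map SL us)"
      and cover: "den \<MM> (BigDisj (map (\<lambda>S. BigConj (map (\<lambda>i. Neg (us ! i)) S))
               (index_sets k (\<lambda>S. real (length S) \<ge> real k / 2)))) = W"
  proof -
    have large: "sum m W \<le> 2 * sum m (W \<inter> A i)" if "i \<in> {..<k}" for i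
    proof -
      have "\<mu> W \<le> 2 * \<mu> (A i)"
        using L that by (simp add: sat_SBigConj sat_SL A_def k_def)
      then show ?thesis
        using A_sub[of i] by (simp add: \<mu>_sum Int_absorb1)
    qed
    have sparse: "2 * card {i \<in> {..<k}. w \<in> A i} \<le> card {..<k}" if "w \<in> W" for w
    proof -
      \<comment> \<open>\<open>S\<close> belongs to a disjunct of the cover that holds at
        \<open>w\<close>. It is disjoint from the indices whose terms hold at \<open>w\<close> and
        fills at least half of \<open>{..<k}\<close>, leaving at most half for them.\<close>
      from that cover obtain S where S: "S \<in> set (subseqs [0..<k])" "real (length S) \<ge> real k / 2"
        and notin: "\<And>i. i \<in> set S \<Longrightarrow> w \<notin> A i"
        by (auto simp: den_BigDisj den_BigConj den_Neg index_sets_def A_def)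
      have "card {i \<in> {..<k}. w \<in> A i} + length S = card ({i \<in> {..<k}. w \<in> A i} \<union> set S)"
        using notin by (subst card_Un_disjoint) (auto simp: length_subseq_upt(1)[OF S(1)])
      also have "\<dots> \<le> card {..<k}"
        using length_subseq_upt(2)[OF S(1)] by (intro card_mono) auto
      finally show ?thesis using S(2) by simp
    qed
    have half: "2 * sum m (W \<inter> A i) = sum m W" if "i < k" for i
      by (rule double_counting_equality(1)[of W "{..<k}" m A])
        (use fin m_pos large sparse that in auto)
    have balanced: "2 * card {i \<in> {..<k}. w \<in> A i} = k" if "w \<in> W" for w
      by (rule double_counting_equality(2)[of W "{..<k}" m A, simplified card_lessThan])
        (use fin m_pos large sparse that in auto)
    have "\<MM> \<Turnstile> SH (us ! i)" if "i < k" for i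
      using half[OF that] A_sub[of i] by (simp add: sat_SH \<mu>_sum Int_absorb1 flip: A_def)
    then have "\<MM> \<Turnstile> SBigConj (map SH us)"
      by (auto simp: sat_SBigConj in_set_conv_nth k_def)
    moreover have "w \<in> ?D" if "w \<in> W" for w
    proof -
      \<comment> \<open>The witness must be all indices whose terms hold at \<open>w\<close>, since
        the chosen disjunct also negates every term outside \<open>S\<close>. By
        \<open>balanced\<close> it has exactly half of the indices.\<close>
      obtain S where S: "S \<in> set (subseqs [0..<k])" "set S = {i \<in> {..<k}. w \<in> A i}"
        by (rule subseq_upt_exists[of "{i \<in> {..<k}. w \<in> A i}" k]) auto
      have "2 * length S = k"
        using balanced[OF that] by (simp add: length_subseq_upt(1)[OF S(1)] S(2))
      then have len: "real (length S) = real k / 2" by linarith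
      show ?thesis
        using that S len
        by (auto simp: den_BigDisj den_BigConj den_Conj den_Neg index_sets_def A_def W_def
            intro!: bexI[of _ S])
    qed
    ultimately show ?thesis by blast
  qed
  then show ?thesis
    using den_subset[of \<MM>] unfolding coherence_def Let_def sat_SImp k_def W_def
    by (simp add: subset_antisym)
qed

lemma axioms_sound:
  assumes "p \<in> axioms" "measurable_model \<MM>"
  shows "\<MM> \<Turnstile> p"
  using assms(1)
proof cases
  case (taut q \<sigma>)
  then show ?thesis by (simp add: sat_psubst tautology_def)
next
  \<comment> \<open>\<open>SE Top\<close> says that there is at least one world, which is part of
    \<open>frame\<close>.\<close>
  case E_A_Top
  then show ?thesis
    using assms(2) by (auto simp: SE_def den_Neg den_Top measurable_model_def model_def frame_def)
next
  case (A_Imp t u)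
  then show ?thesis
    using den_subset[of \<MM> u] by (auto simp: sat_SImp Imp_def den_Disj den_Neg)
next
  case (coh us)
  then show ?thesis using coherence_sound[OF assms(2)] by simp
qed

theorem proposition4p2:
  fixes \<Gamma> :: "sentence set" and \<phi> :: sentence
  assumes "finite \<Gamma>"
    and "\<Gamma> \<turnstile> \<phi>"
  shows "\<forall>\<MM> :: 'w model. measurable_model \<MM> \<longrightarrow> (\<forall>\<psi>\<in>\<Gamma>. \<MM> \<Turnstile> \<psi>) \<longrightarrow> \<MM> \<Turnstile> \<phi>"
proof (intro allI impI)
  fix \<MM> :: "'w model"
  assume "measurable_model \<MM>" and "\<forall>\<psi>\<in>\<Gamma>. \<MM> \<Turnstile> \<psi>"
  with assms(2) show "\<MM> \<Turnstile> \<phi>"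
    by (induction rule: derives.induct) (simp_all add: axioms_sound sat_SImp)
qed

end
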